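(* Let $\mathcal{A}_1,\dots,\mathcal{A}_n$ and $\mathcal{B}$ be path categories and let $\widehat H\colon\prod_i\mathcal{A}_i\to\mathcal{B}$ be a functor satisfying (S1) and (S2) below. If $f_1,\dots,f_n$ are open pathwise-embeddings in $\mathcal{A}_1,\dots,\mathcal{A}_n$ respectively, then $\widehat H(f_1,\dots,f_n)$ is an open pathwise-embedding in $\mathcal{B}$. (S1) If each $e_i$ is an embedding in $\mathcal{A}_i$, then $\widehat H(e_1,\dots,e_n)$ is an embedding. (S2) Every path embedding $e\colon P\rightarrowtail\widehat H(A_1,\dots,A_n)$ has a minimal decomposition $e=\widehat H(e_1,\dots,e_n)\circ e_0$ with $e_0\colon P\to\widehat H(P_1,\dots,P_n)$ and path embeddings $e_i\colon P_i\rightarrowtail A_i$; minimality means that for any decomposition $e=\widehat H(g_1,\dots,g_n)\circ g_0$ with $g_0\colon P\to\widehat H(Q_1,\dots,Q_n)$ and path embeddings $g_i\colon Q_i\rightarrowtail A_i$, there exist (necessarily unique) morphisms $h_i\colon P_i\to Q_i$ with $e_i=g_i\circ h_i$ for all $i$.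
   Context: A path category is a category equipped with a proper factorisation system $(\mathcal{E},\mathcal{M})$ (every morphism factors as $m\circ e$ with $e\in\mathcal{E}$, $m\in\mathcal{M}$; $\mathcal{E}$ and $\mathcal{M}$ determine each other by weak orthogonality, i.e. existence of diagonal fillers of commuting squares; $\mathcal{E}$ consists of epis and $\mathcal{M}$ of monos) together with a chosen class of objects called paths. Members of $\mathcal{M}$ are embeddings; a path embedding is an embedding with domain a path. A morphism $f\colon X\to Y$ is a pathwise-embedding if $f\circ e$ is an embedding for every path embedding $e\colon P\rightarrowtail X$. It is open if for every commutative square $f\circ e=m\circ g$ with $e\colon P\rightarrowtail X$, $g\colon P\rightarrowtail Q$, $m\colon Q\rightarrowtail Y$ path embeddings, there exists $d\colon Q\to X$ with $d\circ g=e$ and $f\circ d=m$. *)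

theory Defs
  imports Main "HOL-Library.FuncSet"
begin

record ('o, 'm) category =
  Obj :: "'o set"
  Arr :: "'m set"
  Dom :: "'m \<Rightarrow> 'o"
  Cod :: "'m \<Rightarrow> 'o"
  Ident :: "'o \<Rightarrow> 'm"
  Comp :: "'m \<Rightarrow> 'm \<Rightarrow> 'm"  (infixr "\<cdot>\<index>" 70)

definition Hom :: "('o, 'm, 'x) category_scheme \<Rightarrow> 'o \<Rightarrow> 'o \<Rightarrow> 'm set" where
  "Hom C X Y = {f \<in> Arr C. Dom C f = X \<and> Cod C f = Y}"

text \<open>Composition is in applicative order: \<open>g \<cdot> f\<close> is \<open>f\<close> followed by \<open>g\<close>.  It is a total
  HOL function, but only its values on composable pairs of arrows matter.\<close>

locale category =
  fixes C :: "('o, 'm, 'x) category_scheme" (structure)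
  assumes Dom_closed: "f \<in> Arr C \<Longrightarrow> Dom C f \<in> Obj C"
    and Cod_closed: "f \<in> Arr C \<Longrightarrow> Cod C f \<in> Obj C"
    and Ident_closed: "X \<in> Obj C \<Longrightarrow> Ident C X \<in> Hom C X X"
    and Comp_closed: "\<lbrakk>f \<in> Hom C X Y; g \<in> Hom C Y Z\<rbrakk> \<Longrightarrow> g \<cdot> f \<in> Hom C X Z"
    and Comp_assoc: "\<lbrakk>f \<in> Hom C W X; g \<in> Hom C X Y; h \<in> Hom C Y Z\<rbrakk>
                     \<Longrightarrow> (h \<cdot> g) \<cdot> f = h \<cdot> (g \<cdot> f)"
    and Comp_Ident_right: "f \<in> Hom C X Y \<Longrightarrow> f \<cdot> Ident C X = f"
    and Comp_Ident_left: "f \<in> Hom C X Y \<Longrightarrow> Ident C Y \<cdot> f = f"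

definition monic :: "('o, 'm, 'x) category_scheme \<Rightarrow> 'm \<Rightarrow> bool" where
  "monic C m \<longleftrightarrow> m \<in> Arr C \<and>
     (\<forall>X. \<forall>u \<in> Hom C X (Dom C m). \<forall>v \<in> Hom C X (Dom C m).
        Comp C m u = Comp C m v \<longrightarrow> u = v)"

definition epic :: "('o, 'm, 'x) category_scheme \<Rightarrow> 'm \<Rightarrow> bool" where
  "epic C e \<longleftrightarrow> e \<in> Arr C \<and>
     (\<forall>Y. \<forall>u \<in> Hom C (Cod C e) Y. \<forall>v \<in> Hom C (Cod C e) Y.
        Comp C u e = Comp C v e \<longrightarrow> u = v)"

text \<open>Weak orthogonality of \<open>e\<close> and \<open>m\<close>: every commuting square with \<open>e\<close> on the left and \<open>m\<close>
  on the right has a (not necessarily unique) diagonal filler.\<close>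

definition weakly_orthogonal :: "('o, 'm, 'x) category_scheme \<Rightarrow> 'm \<Rightarrow> 'm \<Rightarrow> bool" where
  "weakly_orthogonal C e m \<longleftrightarrow>
     (\<forall>u \<in> Hom C (Dom C e) (Dom C m). \<forall>v \<in> Hom C (Cod C e) (Cod C m).
        Comp C m u = Comp C v e \<longrightarrow>
        (\<exists>d \<in> Hom C (Cod C e) (Dom C m). Comp C d e = u \<and> Comp C m d = v))"

record ('o, 'm) path_category = "('o, 'm) category" +
  Quot :: "'m set"
  Emb :: "'m set"
  Path :: "'o set"

text \<open>\<open>Quot\<close> and \<open>Emb\<close> are the left and right class of the proper factorisation system.\<close>

locale path_category = category C
  for C :: "('o, 'm, 'x) path_category_scheme" (structure) +
  assumes factorisation:
      "f \<in> Arr C \<Longrightarrow> \<exists>e \<in> Quot C. \<exists>m \<in> Emb C. Dom C m = Cod C e \<and> f = m \<cdot> e"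
    and Quot_eq: "Quot C = {e \<in> Arr C. \<forall>m \<in> Emb C. weakly_orthogonal C e m}"
    and Emb_eq: "Emb C = {m \<in> Arr C. \<forall>e \<in> Quot C. weakly_orthogonal C e m}"
    and Quot_epic: "e \<in> Quot C \<Longrightarrow> epic C e"
    and Emb_monic: "m \<in> Emb C \<Longrightarrow> monic C m"
    and Path_closed: "Path C \<subseteq> Obj C"

definition path_embeddings :: "('o, 'm, 'x) path_category_scheme \<Rightarrow> 'm set" where
  "path_embeddings C = {e \<in> Emb C. Dom C e \<in> Path C}"

definition pathwise_embedding :: "('o, 'm, 'x) path_category_scheme \<Rightarrow> 'm \<Rightarrow> bool" where
  "pathwise_embedding C f \<longleftrightarrow> f \<in> Arr C \<and>
     (\<forall>e \<in> path_embeddings C. Cod C e = Dom C f \<longrightarrow> Comp C f e \<in> Emb C)"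

definition open_arrow :: "('o, 'm, 'x) path_category_scheme \<Rightarrow> 'm \<Rightarrow> bool" where
  "open_arrow C f \<longleftrightarrow> f \<in> Arr C \<and>
     (\<forall>P Q. \<forall>e \<in> path_embeddings C \<inter> Hom C P (Dom C f).
            \<forall>g \<in> path_embeddings C \<inter> Hom C P Q.
            \<forall>m \<in> path_embeddings C \<inter> Hom C Q (Cod C f).
        Comp C f e = Comp C m g \<longrightarrow>
        (\<exists>d \<in> Hom C Q (Dom C f). Comp C d g = e \<and> Comp C f d = m))"

text \<open>The members of a family of categories share the two types of objects and arrows, but each
  has its own carrier sets, so this does not restrict the families considered.  Objects and arrows
  of the product are extensional functions on the index set.\<close>

definition product_category ::
  "'i set \<Rightarrow> ('i \<Rightarrow> ('o, 'm, 'x) category_scheme) \<Rightarrow> ('i \<Rightarrow> 'o, 'i \<Rightarrow> 'm) category" where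
  "product_category I A =
     \<lparr>Obj = (\<Pi>\<^sub>E i\<in>I. Obj (A i)),
      Arr = (\<Pi>\<^sub>E i\<in>I. Arr (A i)),
      Dom = (\<lambda>f. \<lambda>i\<in>I. Dom (A i) (f i)),
      Cod = (\<lambda>f. \<lambda>i\<in>I. Cod (A i) (f i)),
      Ident = (\<lambda>X. \<lambda>i\<in>I. Ident (A i) (X i)),
      Comp = (\<lambda>g f. \<lambda>i\<in>I. Comp (A i) (g i) (f i))\<rparr>"

lemma Hom_product_category:
  "f \<in> Hom (product_category I A) X Y \<longleftrightarrow>
     f \<in> extensional I \<and> X \<in> extensional I \<and> Y \<in> extensional I \<and>
     (\<forall>i\<in>I. f i \<in> Hom (A i) (X i) (Y i))"
  by (auto simp: Hom_def product_category_def PiE_def Pi_def extensional_def fun_eq_iff)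

lemma category_product_category:
  assumes "\<And>i. i \<in> I \<Longrightarrow> category (A i)"
  shows "category (product_category I A)"
proof -
  note c = assms
  show ?thesis
    apply unfold_locales
    subgoal by (auto simp: product_category_def intro!: category.Dom_closed[OF c])
    subgoal by (auto simp: product_category_def intro!: category.Cod_closed[OF c])
    subgoal unfolding Hom_product_category
      by (auto simp: product_category_def PiE_def Pi_def intro!: category.Ident_closed[OF c])
    subgoal unfolding Hom_product_category
      by (auto simp: product_category_def intro!: category.Comp_closed[OF c])
    subgoal unfolding Hom_product_category
      by (auto simp: product_category_def fun_eq_iff intro!: category.Comp_assoc[OF c])
    subgoal unfolding Hom_product_category
      by (auto simp: product_category_def fun_eq_iff extensional_def
            intro!: category.Comp_Ident_right[OF c])
    subgoal unfolding Hom_product_category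
      by (auto simp: product_category_def fun_eq_iff extensional_def
            intro!: category.Comp_Ident_left[OF c])
    done
qed

locale category_functor = source: category C + target: category D
  for C :: "('o, 'm, 'x) category_scheme" and D :: "('p, 'k, 'y) category_scheme" +
  fixes Fo :: "'o \<Rightarrow> 'p" and Fa :: "'m \<Rightarrow> 'k"
  assumes map_Obj: "X \<in> Obj C \<Longrightarrow> Fo X \<in> Obj D"
    and map_Hom: "f \<in> Hom C X Y \<Longrightarrow> Fa f \<in> Hom D (Fo X) (Fo Y)"
    and map_Ident: "X \<in> Obj C \<Longrightarrow> Fa (Ident C X) = Ident D (Fo X)"
    and map_Comp: "\<lbrakk>f \<in> Hom C X Y; g \<in> Hom C Y Z\<rbrakk>
                   \<Longrightarrow> Fa (Comp C g f) = Comp D (Fa g) (Fa f)"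

definition preserves_embeddings ::
  "'i set \<Rightarrow> ('i \<Rightarrow> ('o, 'm, 'x) path_category_scheme) \<Rightarrow> ('p, 'k, 'y) path_category_scheme
   \<Rightarrow> (('i \<Rightarrow> 'm) \<Rightarrow> 'k) \<Rightarrow> bool" where
  "preserves_embeddings I A B Ha \<longleftrightarrow> (\<forall>e \<in> (\<Pi>\<^sub>E i\<in>I. Emb (A i)). Ha e \<in> Emb B)"

text \<open>\<open>e0\<close> and the family \<open>es\<close> form a decomposition of \<open>e : P \<rightarrow> Ho Xs\<close> as \<open>Ha es \<cdot> e0\<close>, with
  each \<open>es i\<close> a path embedding into \<open>Xs i\<close>; the paths \<open>P i\<close> are the domains of the \<open>es i\<close>.\<close>

definition path_decomposition ::
  "'i set \<Rightarrow> ('i \<Rightarrow> ('o, 'm, 'x) path_category_scheme) \<Rightarrow> ('p, 'k, 'y) path_category_scheme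
   \<Rightarrow> (('i \<Rightarrow> 'o) \<Rightarrow> 'p) \<Rightarrow> (('i \<Rightarrow> 'm) \<Rightarrow> 'k)
   \<Rightarrow> ('i \<Rightarrow> 'o) \<Rightarrow> 'k \<Rightarrow> 'k \<Rightarrow> ('i \<Rightarrow> 'm) \<Rightarrow> bool" where
  "path_decomposition I A B Ho Ha Xs e e0 es \<longleftrightarrow>
     es \<in> (\<Pi>\<^sub>E i\<in>I. path_embeddings (A i)) \<and>
     (\<forall>i\<in>I. Cod (A i) (es i) = Xs i) \<and>
     e0 \<in> Hom B (Dom B e) (Ho (\<lambda>i\<in>I. Dom (A i) (es i))) \<and>
     e = Comp B (Ha es) e0"

definition minimal_path_decomposition ::
  "'i set \<Rightarrow> ('i \<Rightarrow> ('o, 'm, 'x) path_category_scheme) \<Rightarrow> ('p, 'k, 'y) path_category_scheme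
   \<Rightarrow> (('i \<Rightarrow> 'o) \<Rightarrow> 'p) \<Rightarrow> (('i \<Rightarrow> 'm) \<Rightarrow> 'k)
   \<Rightarrow> ('i \<Rightarrow> 'o) \<Rightarrow> 'k \<Rightarrow> 'k \<Rightarrow> ('i \<Rightarrow> 'm) \<Rightarrow> bool" where
  "minimal_path_decomposition I A B Ho Ha Xs e e0 es \<longleftrightarrow>
     path_decomposition I A B Ho Ha Xs e e0 es \<and>
     (\<forall>g0 gs. path_decomposition I A B Ho Ha Xs e g0 gs \<longrightarrow>
        (\<forall>i\<in>I. \<exists>h \<in> Hom (A i) (Dom (A i) (es i)) (Dom (A i) (gs i)).
           es i = Comp (A i) (gs i) h))"

definition has_minimal_path_decompositions ::
  "'i set \<Rightarrow> ('i \<Rightarrow> ('o, 'm, 'x) path_category_scheme) \<Rightarrow> ('p, 'k, 'y) path_category_scheme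
   \<Rightarrow> (('i \<Rightarrow> 'o) \<Rightarrow> 'p) \<Rightarrow> (('i \<Rightarrow> 'm) \<Rightarrow> 'k) \<Rightarrow> bool" where
  "has_minimal_path_decompositions I A B Ho Ha \<longleftrightarrow>
     (\<forall>Xs \<in> (\<Pi>\<^sub>E i\<in>I. Obj (A i)). \<forall>e \<in> path_embeddings B. Cod B e = Ho Xs \<longrightarrow>
        (\<exists>e0 es. minimal_path_decomposition I A B Ho Ha Xs e e0 es))"

end

theory Submission imports Defs begin

text \<open>Let \<open>F = H(f\<^sub>1,\<dots>,f\<^sub>n)\<close>.  Decomposing \<open>e = H(e\<^sub>i) \<cdot> e\<^sub>0\<close> gives \<open>F \<cdot> e = H(f\<^sub>i \<cdot> e\<^sub>i) \<cdot> e\<^sub>0\<close>, a composite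
  of embeddings.  For openness, let \<open>F \<cdot> e = m \<cdot> g\<close> and \<open>m = H(m\<^sub>i) \<cdot> m\<^sub>0\<close>, and take the minimal
  decomposition \<open>H(k\<^sub>i) \<cdot> k\<^sub>0\<close> of the path embedding \<open>F \<cdot> e\<close> itself.  Comparing it with
  \<open>H(f\<^sub>i \<cdot> e\<^sub>i) \<cdot> e\<^sub>0\<close> and \<open>H(m\<^sub>i) \<cdot> (m\<^sub>0 \<cdot> g)\<close> yields \<open>f\<^sub>i \<cdot> e\<^sub>i \<cdot> u\<^sub>i = k\<^sub>i = m\<^sub>i \<cdot> v\<^sub>i\<close>; openness of the \<open>f\<^sub>i\<close>
  fills these squares by some \<open>d\<^sub>i\<close>, and \<open>H(d\<^sub>i) \<cdot> m\<^sub>0\<close> fills the given one.\<close>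

section \<open>Elimination rules for hom-sets, monos, epis and diagonal fillers\<close>

lemma HomD:
  assumes "f \<in> Hom C X Y"
  shows "f \<in> Arr C" "Dom C f = X" "Cod C f = Y"
  using assms by (auto simp: Hom_def)

lemma monicD:
  assumes "monic C m" "m \<in> Hom C Y Z" "u \<in> Hom C X Y" "v \<in> Hom C X Y" "Comp C m u = Comp C m v"
  shows "u = v"
  using assms unfolding monic_def by (auto simp: HomD)

lemma epicD:
  assumes "epic C e" "e \<in> Hom C X Y" "u \<in> Hom C Y Z" "v \<in> Hom C Y Z" "Comp C u e = Comp C v e"
  shows "u = v"
  using assms unfolding epic_def by (auto simp: HomD)

lemma weakly_orthogonalD:
  assumes "weakly_orthogonal C e m" "e \<in> Hom C S T" "m \<in> Hom C X Y"
    and "u \<in> Hom C S X" "v \<in> Hom C T Y" "Comp C m u = Comp C v e"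
  obtains d where "d \<in> Hom C T X" "Comp C d e = u" "Comp C m d = v"
  using assms unfolding weakly_orthogonal_def by (auto simp: HomD)

lemma open_arrowD:
  assumes "open_arrow C f" "f \<in> Hom C X Y"
    and "e \<in> path_embeddings C \<inter> Hom C P X" "g \<in> path_embeddings C \<inter> Hom C P Q"
    and "m \<in> path_embeddings C \<inter> Hom C Q Y" "Comp C f e = Comp C m g"
  obtains d where "d \<in> Hom C Q X" "Comp C d g = e" "Comp C f d = m"
  using assms unfolding open_arrow_def HomD[OF assms(2)] by blast

section \<open>Composition and cancellation of embeddings in a path category\<close>

context path_category
begin

lemma Emb_arr: "m \<in> Emb C \<Longrightarrow> m \<in> Arr C"
  using Emb_eq by blast

lemma Quot_arr: "e \<in> Quot C \<Longrightarrow> e \<in> Arr C"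
  using Quot_eq by blast

lemma Quot_Emb_orthogonal: "e \<in> Quot C \<Longrightarrow> m \<in> Emb C \<Longrightarrow> weakly_orthogonal C e m"
  using Emb_eq by blast

text \<open>Since \<open>Emb C\<close> is exactly the class of arrows weakly orthogonal to
  \<open>Quot C\<close>, membership can be tested by filling squares; the four objects of the square
  are named so that hom-set rules apply directly.\<close>

lemma EmbI:
  assumes "m \<in> Hom C X Y"
    and fill: "\<And>S T e u v. \<lbrakk>e \<in> Quot C; e \<in> Hom C S T; u \<in> Hom C S X; v \<in> Hom C T Y; m \<cdot> u = v \<cdot> e\<rbrakk>
          \<Longrightarrow> \<exists>d \<in> Hom C T X. d \<cdot> e = u \<and> m \<cdot> d = v"
  shows "m \<in> Emb C"
proof -
  have "weakly_orthogonal C e m" if "e \<in> Quot C" for e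
    unfolding weakly_orthogonal_def HomD[OF assms(1)]
    using fill[OF that] Quot_arr[OF that] by (auto simp: Hom_def)
  then show ?thesis
    using HomD(1)[OF assms(1)] by (subst Emb_eq) blast
qed

text \<open>Two fillers in succession: the filler \<open>d1\<close> of the square against
  \<open>m\<close> becomes the lower edge of a square against \<open>k\<close>, whose filler serves
  for the composite.\<close>

lemma Emb_Comp:
  assumes k: "k \<in> Emb C" "k \<in> Hom C X Y" and m: "m \<in> Emb C" "m \<in> Hom C Y Z"
  shows "m \<cdot> k \<in> Emb C"
proof (rule EmbI)
  show "m \<cdot> k \<in> Hom C X Z"
    using Comp_closed k m by blast
  fix S T e u v
  assume e: "e \<in> Quot C" "e \<in> Hom C S T" and u: "u \<in> Hom C S X" and v: "v \<in> Hom C T Z"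
    and eq: "(m \<cdot> k) \<cdot> u = v \<cdot> e"
  have "m \<cdot> (k \<cdot> u) = v \<cdot> e"
    using eq Comp_assoc[OF u k(2) m(2)] by simp
  then obtain d1 where d1: "d1 \<in> Hom C T Y" "d1 \<cdot> e = k \<cdot> u" "m \<cdot> d1 = v"
    using weakly_orthogonalD[OF Quot_Emb_orthogonal[OF e(1) m(1)] e(2) m(2) Comp_closed[OF u k(2)] v]
    by blast
  then obtain d where "d \<in> Hom C T X" "d \<cdot> e = u" "k \<cdot> d = d1"
    using weakly_orthogonalD[OF Quot_Emb_orthogonal[OF e(1) k(1)] e(2) k(2) u d1(1)] by metis
  then show "\<exists>d \<in> Hom C T X. d \<cdot> e = u \<and> (m \<cdot> k) \<cdot> d = v"
    using d1 Comp_assoc[OF _ k(2) m(2)] by metis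
qed

text \<open>Composing the given square with \<open>m\<close> yields a square against
  \<open>m \<cdot> k\<close>, whose filler \<open>d\<close> satisfies
  \<open>d \<cdot> e = u\<close>. The other triangle holds because \<open>k \<cdot> d\<close> and
  \<open>v\<close> agree after precomposition with the epi \<open>e\<close>; properness of the
  factorisation system enters here.\<close>

lemma Emb_cancel:
  assumes mk: "m \<cdot> k \<in> Emb C" and k: "k \<in> Hom C X Y" and m: "m \<in> Hom C Y Z"
  shows "k \<in> Emb C"
proof (rule EmbI[OF k])
  fix S T e u v
  assume e: "e \<in> Quot C" "e \<in> Hom C S T" and u: "u \<in> Hom C S X" and v: "v \<in> Hom C T Y"
    and eq: "k \<cdot> u = v \<cdot> e"
  have "(m \<cdot> k) \<cdot> u = (m \<cdot> v) \<cdot> e"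
    using eq Comp_assoc[OF u k m] Comp_assoc[OF e(2) v m] by simp
  then obtain d where d: "d \<in> Hom C T X" "d \<cdot> e = u"
    using weakly_orthogonalD[OF Quot_Emb_orthogonal[OF e(1) mk] e(2) Comp_closed[OF k m] u
        Comp_closed[OF v m]] by blast
  have "(k \<cdot> d) \<cdot> e = v \<cdot> e"
    using Comp_assoc[OF e(2) d(1) k] d(2) eq by simp
  then have "k \<cdot> d = v"
    using epicD[OF Quot_epic[OF e(1)] e(2) Comp_closed[OF d(1) k] v] by blast
  then show "\<exists>d \<in> Hom C T X. d \<cdot> e = u \<and> k \<cdot> d = v"
    using d by blast
qed

text \<open>\<open>k\<close> and \<open>m \<cdot> k\<close> have the same domain, so being a path is
  inherited and \<open>Emb_cancel\<close> does the rest.\<close>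

lemma path_embedding_cancel:
  assumes "m \<cdot> k \<in> path_embeddings C" "k \<in> Hom C X Y" "m \<in> Hom C Y Z"
  shows "k \<in> path_embeddings C \<inter> Hom C X Y"
  using assms Emb_cancel[OF _ assms(2,3)] Comp_closed[OF assms(2,3)]
  by (auto simp: path_embeddings_def HomD)

lemma path_embedding_Comp:
  assumes "k \<in> path_embeddings C \<inter> Hom C X Y" "m \<in> Emb C" "m \<in> Hom C Y Z"
  shows "m \<cdot> k \<in> path_embeddings C \<inter> Hom C X Z"
  using assms Emb_Comp[of k X Y m Z] Comp_closed[of k X Y m Z]
  by (auto simp: path_embeddings_def HomD)

lemma pathwise_embeddingD:
  assumes "pathwise_embedding C f" "f \<in> Hom C X Y" "e \<in> path_embeddings C \<inter> Hom C P X"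
  shows "f \<cdot> e \<in> path_embeddings C \<inter> Hom C P Y"
  using assms Comp_closed[of e P X f Y]
  by (auto simp: pathwise_embedding_def path_embeddings_def HomD)

end

section \<open>Functors on a product of path categories that satisfy (S1) and (S2)\<close>

locale path_multifunctor = target: path_category B +
  category_functor "product_category I A" B Ho Ha
  for I :: "'i set" and A :: "'i \<Rightarrow> ('o, 'm, 'x) path_category_scheme"
    and B :: "('p, 'k, 'y) path_category_scheme" and Ho :: "('i \<Rightarrow> 'o) \<Rightarrow> 'p"
    and Ha :: "('i \<Rightarrow> 'm) \<Rightarrow> 'k" +
  assumes source_path_category: "i \<in> I \<Longrightarrow> path_category (A i)"
    and embeddings: "preserves_embeddings I A B Ha"
    and decompositions: "has_minimal_path_decompositions I A B Ho Ha"
begin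

text \<open>Objects and arrows of the product are extensional on \<open>I\<close>. Restricting just
  before \<open>Ho\<close> and \<open>Ha\<close> lets families be handled as arbitrary
  functions.\<close>

abbreviation HO :: "('i \<Rightarrow> 'o) \<Rightarrow> 'p" where "HO X \<equiv> Ho (restrict X I)"
abbreviation HA :: "('i \<Rightarrow> 'm) \<Rightarrow> 'k" where "HA h \<equiv> Ha (restrict h I)"

lemma HA_Hom:
  assumes "\<And>i. i \<in> I \<Longrightarrow> h i \<in> Hom (A i) (X i) (Y i)"
  shows "HA h \<in> Hom B (HO X) (HO Y)"
  using assms by (intro map_Hom) (auto simp: Hom_product_category)

text \<open>The composite \<open>c\<close> is a separate family constrained only on
  \<open>I\<close>, so one family such as \<open>ks\<close> can be factored in several ways.\<close>

lemma HA_Comp: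
  assumes "\<And>i. i \<in> I \<Longrightarrow> h i \<in> Hom (A i) (X i) (Y i)"
    and "\<And>i. i \<in> I \<Longrightarrow> k i \<in> Hom (A i) (Y i) (Z i)"
    and "\<And>i. i \<in> I \<Longrightarrow> c i = Comp (A i) (k i) (h i)"
  shows "HA c = Comp B (HA k) (HA h)"
proof -
  have "Comp (product_category I A) (restrict k I) (restrict h I) = restrict c I"
    using assms(3) by (auto simp: product_category_def restrict_def fun_eq_iff)
  then show ?thesis
    using map_Comp[of "restrict h I" "restrict X I" "restrict Y I" "restrict k I" "restrict Z I"] assms(1,2)
    by (simp add: Hom_product_category)
qed

lemma HA_Emb:
  assumes "\<And>i. i \<in> I \<Longrightarrow> h i \<in> path_embeddings (A i) \<inter> Hom (A i) (X i) (Y i)"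
  shows "HA h \<in> Emb B"
  using embeddings assms unfolding preserves_embeddings_def path_embeddings_def by auto

text \<open>Repackages (S2) with named families of paths, hiding the restrictions; the last clause
  is minimality.\<close>

lemma minimal_decomposition:
  assumes e: "e \<in> path_embeddings B \<inter> Hom B P (HO X)" and X: "\<And>i. i \<in> I \<Longrightarrow> X i \<in> Obj (A i)"
  obtains p q Ps where
    "\<And>i. i \<in> I \<Longrightarrow> p i \<in> path_embeddings (A i) \<inter> Hom (A i) (Ps i) (X i)"
    "q \<in> Hom B P (HO Ps)" "e = Comp B (HA p) q"
    "\<And>r s Qs i. \<lbrakk>\<And>i. i \<in> I \<Longrightarrow> r i \<in> path_embeddings (A i) \<inter> Hom (A i) (Qs i) (X i);
        s \<in> Hom B P (HO Qs); e = Comp B (HA r) s; i \<in> I\<rbrakk>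
      \<Longrightarrow> \<exists>h \<in> Hom (A i) (Ps i) (Qs i). p i = Comp (A i) (r i) h"
proof -
  have arr: "m \<in> Arr (A i)" if "m \<in> path_embeddings (A i)" "i \<in> I" for m i
    using that path_category.Emb_arr[OF source_path_category] by (auto simp: path_embeddings_def)
  have "restrict X I \<in> (\<Pi>\<^sub>E i\<in>I. Obj (A i))"
    using X by auto
  then obtain q p where "minimal_path_decomposition I A B Ho Ha (restrict X I) e q p"
    using decompositions e unfolding has_minimal_path_decompositions_def by (blast dest: HomD(3))
  then have dec: "path_decomposition I A B Ho Ha (restrict X I) e q p"
    and min: "\<And>s r i. path_decomposition I A B Ho Ha (restrict X I) e s r \<Longrightarrow> i \<in> I
        \<Longrightarrow> \<exists>h \<in> Hom (A i) (Dom (A i) (p i)) (Dom (A i) (r i)). p i = Comp (A i) (r i) h"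
    by (auto simp: minimal_path_decomposition_def)
  have p: "p \<in> (\<Pi>\<^sub>E i\<in>I. path_embeddings (A i))" "\<And>i. i \<in> I \<Longrightarrow> Cod (A i) (p i) = X i"
    "q \<in> Hom B P (HO (\<lambda>i. Dom (A i) (p i)))" "e = Comp B (Ha p) q"
    using dec e by (auto simp: path_decomposition_def HomD)
  show ?thesis
  proof
    show "p i \<in> path_embeddings (A i) \<inter> Hom (A i) (Dom (A i) (p i)) (X i)" if "i \<in> I" for i
      using p(1,2) arr that by (auto simp: Hom_def PiE_iff)
    show "q \<in> Hom B P (HO (\<lambda>i. Dom (A i) (p i)))"
      by (fact p(3))
    show "e = Comp B (HA p) q"
      \<comment> \<open>\<open>p\<close> is already extensional, so restricting it to
        \<open>I\<close> changes nothing.\<close>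
      using p(4) p(1) by (metis PiE_restrict)
  next
    fix r s Qs i
    assume r: "\<And>i. i \<in> I \<Longrightarrow> r i \<in> path_embeddings (A i) \<inter> Hom (A i) (Qs i) (X i)"
      and s: "s \<in> Hom B P (HO Qs)" and eq: "e = Comp B (HA r) s" and i: "i \<in> I"
    \<comment> \<open>\<open>path_decomposition\<close> reads the paths off as domains of the
      arrows; on \<open>I\<close> these are the given \<open>Qs\<close>.\<close>
    have "(\<lambda>i\<in>I. Dom (A i) (restrict r I i)) = restrict Qs I"
      using r by (intro restrict_ext) (simp add: Hom_def)
    moreover have "Dom B e = P"
      using e by (auto simp: HomD)
    ultimately have "path_decomposition I A B Ho Ha (restrict X I) e s (restrict r I)"
      using r s eq by (auto simp: path_decomposition_def Hom_def)
    from min[OF this i] r i show "\<exists>h \<in> Hom (A i) (Dom (A i) (p i)) (Qs i). p i = Comp (A i) (r i) h"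
      by (auto simp: Hom_def)
  qed
qed

section \<open>The image of a family of pathwise-embeddings\<close>

context
  fixes f X Y
  assumes f: "\<And>i. i \<in> I \<Longrightarrow> f i \<in> Hom (A i) (X i) (Y i)"
    and pathwise: "\<And>i. i \<in> I \<Longrightarrow> pathwise_embedding (A i) (f i)"
begin

lemma f_Obj:
  assumes "i \<in> I"
  shows "X i \<in> Obj (A i)" "Y i \<in> Obj (A i)"
proof -
  interpret path_category "A i" by (rule source_path_category[OF assms])
  show "X i \<in> Obj (A i)" "Y i \<in> Obj (A i)"
    using Dom_closed Cod_closed HomD[OF f[OF assms]] by metis+
qed

lemma f_Comp_path_embedding:
  assumes "i \<in> I" "p \<in> path_embeddings (A i) \<inter> Hom (A i) P (X i)"
  shows "Comp (A i) (f i) p \<in> path_embeddings (A i) \<inter> Hom (A i) P (Y i)"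
  using path_category.pathwise_embeddingD[OF source_path_category pathwise f] assms by blast

lemma HA_f_Hom: "HA f \<in> Hom B (HO X) (HO Y)"
  using f by (rule HA_Hom)

lemma HA_pathwise_embedding: "pathwise_embedding B (HA f)"
  unfolding pathwise_embedding_def HomD[OF HA_f_Hom]
proof (intro conjI ballI impI)
  fix e assume "e \<in> path_embeddings B" "Cod B e = HO X"
  then have e: "e \<in> path_embeddings B \<inter> Hom B (Dom B e) (HO X)"
    using target.Emb_arr by (auto simp: Hom_def path_embeddings_def)
  obtain p q Ps where p: "\<And>i. i \<in> I \<Longrightarrow> p i \<in> path_embeddings (A i) \<inter> Hom (A i) (Ps i) (X i)"
    and q: "q \<in> Hom B (Dom B e) (HO Ps)" and eq: "e = Comp B (HA p) q"
    using minimal_decomposition[OF e f_Obj(1)] by metis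
  define c where "c = (\<lambda>i. Comp (A i) (f i) (p i))"
  have pH: "HA p \<in> Hom B (HO Ps) (HO X)"
    using p by (intro HA_Hom) auto
  have c: "c i \<in> path_embeddings (A i) \<inter> Hom (A i) (Ps i) (Y i)" if "i \<in> I" for i
    unfolding c_def using f_Comp_path_embedding[OF that p[OF that]] .
  have "HA c = Comp B (HA f) (HA p)"
    using p f by (intro HA_Comp[where X = Ps]) (auto simp: c_def)
  then have "Comp B (HA f) e = Comp B (HA c) q"
    using eq target.Comp_assoc[OF q pH HA_f_Hom] by simp
  \<comment> \<open>Cancellation applied to the embedding \<open>e\<close>, which factors as
    \<open>HA p\<close> after \<open>q\<close>.\<close>
  moreover have "q \<in> Emb B"
    using e eq target.Emb_cancel[OF _ q pH] by (auto simp: path_embeddings_def)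
  then have "Comp B (HA c) q \<in> Emb B"
    using target.Emb_Comp[OF _ q HA_Emb[OF c] HA_Hom] c by blast
  ultimately show "Comp B (HA f) e \<in> Emb B"
    by simp
qed (use HomD(1)[OF HA_f_Hom] in simp)

lemma HA_open:
  assumes op: "\<And>i. i \<in> I \<Longrightarrow> open_arrow (A i) (f i)"
  shows "open_arrow B (HA f)"
  unfolding open_arrow_def HomD[OF HA_f_Hom]
proof (intro conjI allI ballI impI)
  fix P Q e g m
  assume e: "e \<in> path_embeddings B \<inter> Hom B P (HO X)" and g: "g \<in> path_embeddings B \<inter> Hom B P Q"
    and m: "m \<in> path_embeddings B \<inter> Hom B Q (HO Y)" and sq: "Comp B (HA f) e = Comp B m g"
  note fH = HA_f_Hom
  have gH: "g \<in> Hom B P Q"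
    using g by blast
  obtain es e0 Ps where
    es: "\<And>i. i \<in> I \<Longrightarrow> es i \<in> path_embeddings (A i) \<inter> Hom (A i) (Ps i) (X i)"
    and e0: "e0 \<in> Hom B P (HO Ps)" and e_eq: "e = Comp B (HA es) e0"
    using minimal_decomposition[OF e f_Obj(1)] by metis
  obtain ms m0 Qs where
    ms: "\<And>i. i \<in> I \<Longrightarrow> ms i \<in> path_embeddings (A i) \<inter> Hom (A i) (Qs i) (Y i)"
    and m0: "m0 \<in> Hom B Q (HO Qs)" and m_eq: "m = Comp B (HA ms) m0"
    using minimal_decomposition[OF m f_Obj(2)] by metis
  \<comment> \<open>The first half of the result makes this diagonal a path embedding, so that (S2)
    applies to it.\<close>
  have Fe: "Comp B (HA f) e \<in> path_embeddings B \<inter> Hom B P (HO Y)"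
    by (rule target.pathwise_embeddingD[OF HA_pathwise_embedding fH e])
  obtain ks k0 Ks where
    ks: "\<And>i. i \<in> I \<Longrightarrow> ks i \<in> path_embeddings (A i) \<inter> Hom (A i) (Ks i) (Y i)"
    and k0: "k0 \<in> Hom B P (HO Ks)" and k_eq: "Comp B (HA f) e = Comp B (HA ks) k0"
    and k_min: "\<And>r s Rs i. \<lbrakk>\<And>i. i \<in> I \<Longrightarrow> r i \<in> path_embeddings (A i) \<inter> Hom (A i) (Rs i) (Y i);
        s \<in> Hom B P (HO Rs); Comp B (HA f) e = Comp B (HA r) s; i \<in> I\<rbrakk>
      \<Longrightarrow> \<exists>h \<in> Hom (A i) (Ks i) (Rs i). ks i = Comp (A i) (r i) h"
    using minimal_decomposition[OF Fe f_Obj(2)] by metis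
  define fe where "fe = (\<lambda>i. Comp (A i) (f i) (es i))"
  have fe: "fe i \<in> path_embeddings (A i) \<inter> Hom (A i) (Ps i) (Y i)" if "i \<in> I" for i
    unfolding fe_def using f_Comp_path_embedding[OF that es[OF that]] .
  have esH: "HA es \<in> Hom B (HO Ps) (HO X)" using es by (intro HA_Hom) auto
  have msH: "HA ms \<in> Hom B (HO Qs) (HO Y)" using ms by (intro HA_Hom) auto
  have feH: "HA fe \<in> Hom B (HO Ps) (HO Y)" using fe by (intro HA_Hom) auto
  have "HA fe = Comp B (HA f) (HA es)"
    using es f by (intro HA_Comp[where X = Ps]) (auto simp: fe_def)
  then have fe_eq: "Comp B (HA f) e = Comp B (HA fe) e0"
    using e_eq target.Comp_assoc[OF e0 esH fH] by simp
  have ms_eq: "Comp B (HA f) e = Comp B (HA ms) (Comp B m0 g)"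
    using sq m_eq target.Comp_assoc[OF gH m0 msH] by simp
  have m0g: "Comp B m0 g \<in> Hom B P (HO Qs)"
    by (rule target.Comp_closed[OF gH m0])
  obtain u where u: "\<And>i. i \<in> I \<Longrightarrow> u i \<in> Hom (A i) (Ks i) (Ps i)"
      "\<And>i. i \<in> I \<Longrightarrow> ks i = Comp (A i) (fe i) (u i)"
    using k_min[OF fe e0 fe_eq] by metis
  obtain v where v: "\<And>i. i \<in> I \<Longrightarrow> v i \<in> Hom (A i) (Ks i) (Qs i)"
      "\<And>i. i \<in> I \<Longrightarrow> ks i = Comp (A i) (ms i) (v i)"
    using k_min[OF ms m0g ms_eq] by metis
  define w where "w = (\<lambda>i. Comp (A i) (es i) (u i))"
  \<comment> \<open>Openness of \<open>f i\<close> requires \<open>w i\<close> and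
    \<open>v i\<close> to be path embeddings. Both facts come from cancellation, as
    \<open>u i\<close> and \<open>v i\<close> are right factors of the path embedding
    \<open>ks i\<close>.\<close>
  have "\<exists>d \<in> Hom (A i) (Qs i) (X i). Comp (A i) d (v i) = w i \<and> Comp (A i) (f i) d = ms i"
    if i: "i \<in> I" for i
  proof -
    interpret path_category "A i" by (rule source_path_category[OF i])
    have "u i \<in> path_embeddings (A i) \<inter> Hom (A i) (Ks i) (Ps i)"
      using path_embedding_cancel[OF _ u(1)[OF i], of "fe i" "Y i"] ks[OF i] fe[OF i] u(2)[OF i] by auto
    then have wi: "w i \<in> path_embeddings (A i) \<inter> Hom (A i) (Ks i) (X i)"
      unfolding w_def using path_embedding_Comp es[OF i] by (auto simp: path_embeddings_def)
    have vi: "v i \<in> path_embeddings (A i) \<inter> Hom (A i) (Ks i) (Qs i)"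
      using path_embedding_cancel[OF _ v(1)[OF i], of "ms i" "Y i"] ks[OF i] ms[OF i] v(2)[OF i] by auto
    \<comment> \<open>Both sides equal \<open>ks i\<close>.\<close>
    have "Comp (A i) (f i) (w i) = Comp (A i) (ms i) (v i)"
      using Comp_assoc[OF u(1)[OF i] _ f[OF i], of "es i"] es[OF i] u(2)[OF i] v(2)[OF i]
      by (simp add: w_def fe_def)
    from open_arrowD[OF op[OF i] f[OF i] wi vi ms[OF i] this] show ?thesis by blast
  qed
  then obtain d where d: "\<And>i. i \<in> I \<Longrightarrow> d i \<in> Hom (A i) (Qs i) (X i)"
      "\<And>i. i \<in> I \<Longrightarrow> w i = Comp (A i) (d i) (v i)"
      "\<And>i. i \<in> I \<Longrightarrow> ms i = Comp (A i) (f i) (d i)"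
    by metis
  note uH = HA_Hom[OF u(1), simplified] and vH = HA_Hom[OF v(1), simplified]
    and dH = HA_Hom[OF d(1), simplified]
  \<comment> \<open>By (S1) \<open>HA fe\<close> is an embedding, hence monic. Cancelling it from
    two factorisations of the diagonal recovers \<open>e0\<close> from \<open>k0\<close>; the same
    is then done with \<open>HA ms\<close>.\<close>
  have "HA ks = Comp B (HA fe) (HA u)"
    using fe u by (intro HA_Comp[where X = Ks]) auto
  then have "Comp B (HA fe) (Comp B (HA u) k0) = Comp B (HA fe) e0"
    using k_eq fe_eq target.Comp_assoc[OF k0 uH feH] by simp
  then have u_k0: "Comp B (HA u) k0 = e0"
    using monicD[OF target.Emb_monic[OF HA_Emb[OF fe]] feH target.Comp_closed[OF k0 uH] e0] by blast
  have "HA ks = Comp B (HA ms) (HA v)"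
    using ms v by (intro HA_Comp[where X = Ks]) auto
  then have "Comp B (HA ms) (Comp B (HA v) k0) = Comp B (HA ms) (Comp B m0 g)"
    using k_eq ms_eq target.Comp_assoc[OF k0 vH msH] by simp
  then have v_k0: "Comp B (HA v) k0 = Comp B m0 g"
    using monicD[OF target.Emb_monic[OF HA_Emb[OF ms]] msH target.Comp_closed[OF k0 vH] m0g] by blast
  have w_u: "HA w = Comp B (HA es) (HA u)"
    using es u by (intro HA_Comp[where X = Ks]) (auto simp: w_def)
  have w_v: "HA w = Comp B (HA d) (HA v)"
    using d v by (intro HA_Comp[where X = Ks]) auto
  \<comment> \<open>Upper triangle: \<open>m0\<close> after \<open>g\<close> is traded for
    \<open>HA v\<close> after \<open>k0\<close>, then \<open>w\<close> is switched from its
    factorisation through \<open>d\<close> to the one through \<open>es\<close>.\<close>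
  have "Comp B (Comp B (HA d) m0) g = Comp B (HA d) (Comp B (HA v) k0)"
    using target.Comp_assoc[OF gH m0 dH] v_k0 by simp
  also have "\<dots> = Comp B (HA es) (Comp B (HA u) k0)"
    using target.Comp_assoc[OF k0 vH dH] target.Comp_assoc[OF k0 uH esH] w_u w_v by simp
  also have "\<dots> = e"
    using u_k0 e_eq by simp
  finally have left: "Comp B (Comp B (HA d) m0) g = e" .
  \<comment> \<open>Lower triangle: functoriality applied to the lower triangles in the
    components.\<close>
  have "HA ms = Comp B (HA f) (HA d)"
    using d f by (intro HA_Comp[where X = Qs]) auto
  then have "Comp B (HA f) (Comp B (HA d) m0) = m"
    using m_eq target.Comp_assoc[OF m0 dH fH] by simp
  with left show "\<exists>d \<in> Hom B Q (HO X). Comp B d g = e \<and> Comp B (HA f) d = m"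
    using target.Comp_closed[OF m0 dH] by blast
qed (use HomD(1)[OF HA_f_Hom] in simp)

end

end

theorem theorem5p17:
  fixes n :: nat
    and A :: "nat \<Rightarrow> ('o, 'm) path_category"
    and B :: "('p, 'k) path_category"
    and Ho :: "(nat \<Rightarrow> 'o) \<Rightarrow> 'p" and Ha :: "(nat \<Rightarrow> 'm) \<Rightarrow> 'k"
    and f :: "nat \<Rightarrow> 'm"
  assumes "\<And>i. i \<in> {1..n} \<Longrightarrow> path_category (A i)"
    and "path_category B"
    and "category_functor (product_category {1..n} A) B Ho Ha"
    and S1: "preserves_embeddings {1..n} A B Ha"
    and S2: "has_minimal_path_decompositions {1..n} A B Ho Ha"
    and "\<And>i. i \<in> {1..n} \<Longrightarrow> open_arrow (A i) (f i) \<and> pathwise_embedding (A i) (f i)"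
  shows "open_arrow B (Ha (\<lambda>i\<in>{1..n}. f i)) \<and> pathwise_embedding B (Ha (\<lambda>i\<in>{1..n}. f i))"
proof -
  interpret path_multifunctor "{1..n}" A B Ho Ha
    using assms(1-5) by (intro path_multifunctor.intro path_multifunctor_axioms.intro)
  \<comment> \<open>The object families \<open>X\<close> and \<open>Y\<close> of the general lemmas
    become the domains and codomains of the \<open>f i\<close>.\<close>
  have f: "f i \<in> Hom (A i) (Dom (A i) (f i)) (Cod (A i) (f i))" if "i \<in> {1..n}" for i
    using assms(6)[OF that] by (auto simp: Hom_def open_arrow_def)
  then show ?thesis
    using HA_open[OF f] HA_pathwise_embedding[OF f] assms(6) by simp
qed

end
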